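(* Let $p\in(0,\infty)$, let $(X,d)$ be a metric space and let $K>0$. (1) If for all $w,x,y,z\in X$ $$\frac1{2^p}\min\{d(w,x)^p,d(w,y)^p\}+\frac{d(x,y)^p}{4^pK^p}\le\frac12d(z,w)^p+\frac12\max\{d(z,x)^p,d(z,y)^p\},$$ then $X$ is fork $p$-convex; moreover $\Pi^f_p(X)\le4K$. (2) If for all $w,x,y,z\in X$ $$\frac1{2^p}\min\{d(w,x)^p,d(w,y)^p\}+\frac{d(x,y)^p}{4^pK^p}\le\max\{d(z,w)^p,d(z,x)^p,d(z,y)^p\},$$ then $X$ is infrasup-fork $p$-convex; moreover $\Pi^{isf}_p(X)\le4K$.
   Context: **Binary tree.** $\mathsf B_h$ is the complete binary tree of height $h$: its vertex set is $\bigcup_{\ell=0}^{h}\{-1,1\}^\ell$ (with $\{-1,1\}^0=\{\emptyset\}$), and its edges are the pairs $\{\varepsilon,(\varepsilon,\delta)\}$ with $\varepsilon\in\{-1,1\}^\ell$, $0\le\ell<h$, $\delta\in\{-1,1\}$; it carries the shortest path metric. Parenthesized expressions such as $(\varepsilon,-1,\delta)$ denote concatenation. **Fork $p$-convexity.** $(X,d)$ is fork $p$-convex if there is $\Pi>0$ such that for all $k\ge1$ and all $f\colon\mathsf B_{2^k}\to X$, $$\sum_{s=1}^{k-1}\frac1{2^{k-1-s}}\sum_{t=1}^{2^{k-1-s}}\ \min_{\varepsilon\in\{-1,1\}^{t2^{s+1}-2^s}}\ \min_{\delta,\delta'\in\{-1,1\}^{2^s-1}}\frac{d(f(\varepsilon,-1,\delta),f(\varepsilon,1,\delta'))^p}{2^{sp}}\le\Pi^p\frac1{2^k}\sum_{\ell=1}^{2^k}\max_{\varepsilon\in\{-1,1\}^\ell}d(f(\varepsilon_1,\dots,\varepsilon_{\ell-1}),f(\varepsilon_1,\dots,\varepsilon_\ell))^p.$$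 $\Pi^f_p(X)$ is the least such $\Pi$. **Infrasup-fork $p$-convexity.** $(X,d)$ is infrasup-fork $p$-convex if there is $C>0$ such that for all $k\ge1$ and all $f\colon\mathsf B_{2^k}\to X$, $$\Big(\sum_{s=1}^{k-1}\ \min_{\varepsilon\in\mathsf B_{2^k-2^s}}\ \min_{\delta,\delta'\in\{-1,1\}^{2^s-1}}\frac{d(f(\varepsilon,-1,\delta),f(\varepsilon,1,\delta'))^p}{2^{sp}}\Big)^{1/p}\le C\,\mathrm{Lip}(f),$$ where $\mathrm{Lip}(f)$ is the Lipschitz constant of $f$. $\Pi^{isf}_p(X)$ is the least such $C$. *)

theory Defs
  imports "HOL-Analysis.Abstract_Metric_Spaces"
begin

text \<open>
  A sign sequence is a list over \<open>{-1, 1}\<close>, the first sign being the head of the list; the root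
  of the tree is \<open>[]\<close> and concatenation of sequences is \<open>@\<close>.
\<close>

definition signs :: "nat \<Rightarrow> int list set" where
  "signs l = {\<epsilon>. set \<epsilon> \<subseteq> {-1, 1} \<and> length \<epsilon> = l}"

definition tree_verts :: "nat \<Rightarrow> int list set" where
  "tree_verts h = (\<Union>l\<le>h. signs l)"

text \<open>Each undirected edge is represented by both of its orientations.\<close>

definition tree_edges :: "nat \<Rightarrow> (int list \<times> int list) set" where
  "tree_edges h =
     (let E = {(\<epsilon>, \<epsilon> @ [\<delta>]) | \<epsilon> \<delta> l. l < h \<and> \<epsilon> \<in> signs l \<and> \<delta> \<in> {-1, 1}} in E \<union> E\<inverse>)"

text \<open>The relational power \<open>tree_edges h ^^ n\<close> relates the endpoints of walks of length \<open>n\<close>.\<close>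

definition tree_dist :: "nat \<Rightarrow> int list \<Rightarrow> int list \<Rightarrow> nat" where
  "tree_dist h u v = (LEAST n. (u, v) \<in> tree_edges h ^^ n)"

definition tree_Lip :: "('a \<Rightarrow> 'a \<Rightarrow> real) \<Rightarrow> nat \<Rightarrow> (int list \<Rightarrow> 'a) \<Rightarrow> real" where
  "tree_Lip d h f =
     Inf {L. L \<ge> 0 \<and> (\<forall>u\<in>tree_verts h. \<forall>v\<in>tree_verts h. d (f u) (f v) \<le> L * real (tree_dist h u v))}"

text \<open>
  The smallest normalised \<open>p\<close>-th power of the distance between the tips of a fork of scale
  \<open>2 ^ s\<close> branching at the vertex \<open>\<epsilon>\<close>.
\<close>

definition fork_min ::
    "('a \<Rightarrow> 'a \<Rightarrow> real) \<Rightarrow> real \<Rightarrow> (int list \<Rightarrow> 'a) \<Rightarrow> nat \<Rightarrow> int list \<Rightarrow> real" where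
  "fork_min d p f s \<epsilon> =
     (MIN (\<delta>, \<delta>') \<in> signs (2 ^ s - 1) \<times> signs (2 ^ s - 1).
        d (f (\<epsilon> @ [-1] @ \<delta>)) (f (\<epsilon> @ [1] @ \<delta>')) powr p / 2 powr (real s * p))"

definition fork_convex_with :: "'a set \<Rightarrow> ('a \<Rightarrow> 'a \<Rightarrow> real) \<Rightarrow> real \<Rightarrow> real \<Rightarrow> bool" where
  "fork_convex_with X d p C \<longleftrightarrow>
     (\<forall>k\<ge>1. \<forall>f \<in> tree_verts (2 ^ k) \<rightarrow> X.
        (\<Sum>s = 1..k - 1. 1 / 2 ^ (k - 1 - s) *
           (\<Sum>t = 1..2 ^ (k - 1 - s). MIN \<epsilon> \<in> signs (t * 2 ^ (s + 1) - 2 ^ s). fork_min d p f s \<epsilon>))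
        \<le> C powr p * (1 / 2 ^ k) *
           (\<Sum>l = 1..2 ^ k. MAX \<epsilon> \<in> signs l. d (f (take (l - 1) \<epsilon>)) (f \<epsilon>) powr p))"

definition fork_convex :: "'a set \<Rightarrow> ('a \<Rightarrow> 'a \<Rightarrow> real) \<Rightarrow> real \<Rightarrow> bool" where
  "fork_convex X d p \<longleftrightarrow> (\<exists>C>0. fork_convex_with X d p C)"

text \<open>
  An infimum, since the best constant of a space with at most one point is \<open>0\<close>, which is not
  attained among the positive constants. The value is meaningful only if \<open>fork_convex X d p\<close>.
\<close>

definition fork_const :: "'a set \<Rightarrow> ('a \<Rightarrow> 'a \<Rightarrow> real) \<Rightarrow> real \<Rightarrow> real" where
  "fork_const X d p = Inf {C. C > 0 \<and> fork_convex_with X d p C}"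

definition isfork_convex_with :: "'a set \<Rightarrow> ('a \<Rightarrow> 'a \<Rightarrow> real) \<Rightarrow> real \<Rightarrow> real \<Rightarrow> bool" where
  "isfork_convex_with X d p C \<longleftrightarrow>
     (\<forall>k\<ge>1. \<forall>f \<in> tree_verts (2 ^ k) \<rightarrow> X.
        (\<Sum>s = 1..k - 1. MIN \<epsilon> \<in> tree_verts (2 ^ k - 2 ^ s). fork_min d p f s \<epsilon>) powr (1 / p)
        \<le> C * tree_Lip d (2 ^ k) f)"

definition isfork_convex :: "'a set \<Rightarrow> ('a \<Rightarrow> 'a \<Rightarrow> real) \<Rightarrow> real \<Rightarrow> bool" where
  "isfork_convex X d p \<longleftrightarrow> (\<exists>C>0. isfork_convex_with X d p C)"

definition isfork_const :: "'a set \<Rightarrow> ('a \<Rightarrow> 'a \<Rightarrow> real) \<Rightarrow> real \<Rightarrow> real" where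
  "isfork_const X d p = Inf {C. C > 0 \<and> isfork_convex_with X d p C}"

end

(* For a vertex u and a sign delta, let B_s(u, delta) be the least d(f u, f v)^p / 2^(sp) over the
   descendants v of u at depth 2^s that pass through (u, delta). The four-point inequality, applied
   at the vertices that attain these minima, shows that B_s decreases from s to s + 1 by at least the
   normalised fork term of scale s divided by (4K)^p, up to averaging over the two halves of a block
   of 2^(s+1) levels in part (1) and up to a maximum in part (2). After maximising B_s over u and
   delta, this telescopes in s, and B_0 is the p-th power of the length of the image of an edge. *)
theory Submission
  imports Defs
begin

section \<open>Sign sequences and fork minima\<close>

lemma finite_signs [simp]: "finite (signs l)"
  unfolding signs_def by (rule finite_lists_length_eq) simp

lemma signs_nonempty [simp]: "signs l \<noteq> {}"
proof -
  have "replicate l 1 \<in> signs l" by (auto simp: signs_def)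
  then show ?thesis by blast
qed

lemma signs_0 [simp]: "signs 0 = {[]}"
  by (auto simp: signs_def)

lemma signs_append:
  assumes "u \<in> signs a" "\<delta> \<in> {-1, 1}" "\<eta> \<in> signs b" "a + b + 1 = c"
  shows "u @ [\<delta>] @ \<eta> \<in> signs c"
  using assms by (auto simp: signs_def)

lemma finite_tree_verts [simp]: "finite (tree_verts h)"
  by (simp add: tree_verts_def)

lemma signs_subset_tree_verts: "l \<le> h \<Longrightarrow> signs l \<subseteq> tree_verts h"
  by (auto simp: tree_verts_def)

lemma tree_verts_nonempty [simp]: "tree_verts h \<noteq> {}"
  by (metis signs_nonempty signs_subset_tree_verts order_refl subset_empty)

lemma fork_min_le:
  assumes "\<delta> \<in> signs (2 ^ s - 1)" "\<delta>' \<in> signs (2 ^ s - 1)"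
  shows "fork_min d p f s \<epsilon>
    \<le> d (f (\<epsilon> @ [-1] @ \<delta>)) (f (\<epsilon> @ [1] @ \<delta>')) powr p / 2 powr (real s * p)"
  unfolding fork_min_def
  by (rule Min_le) (use assms in \<open>auto intro!: image_eqI[of _ _ "(\<delta>, \<delta>')"]\<close>)

lemma fork_min_nonneg: "0 \<le> fork_min d p f s \<epsilon>"
  unfolding fork_min_def by (subst Min_ge_iff) auto

section \<open>Branch minima and their recursion from one scale to the next\<close>

text \<open>The first sign stays fixed so that the minimisers for the two signs at one vertex lie in
  different branches and are therefore the tips of a fork. A minimum over all descendants would not
  guarantee this.\<close>

definition branch_min ::
    "('a \<Rightarrow> 'a \<Rightarrow> real) \<Rightarrow> real \<Rightarrow> (int list \<Rightarrow> 'a) \<Rightarrow> nat \<Rightarrow> int list \<Rightarrow> int \<Rightarrow> real" where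
  "branch_min d p f s u \<delta> =
     (MIN \<eta> \<in> signs (2 ^ s - 1). d (f u) (f (u @ [\<delta>] @ \<eta>)) powr p / 2 powr (real s * p))"

lemma branch_min_le:
  assumes "\<eta> \<in> signs (2 ^ s - 1)"
  shows "branch_min d p f s u \<delta> \<le> d (f u) (f (u @ [\<delta>] @ \<eta>)) powr p / 2 powr (real s * p)"
  unfolding branch_min_def by (rule Min_le) (use assms in auto)

lemma branch_min_attained:
  obtains \<eta> where "\<eta> \<in> signs (2 ^ s - 1)"
    "branch_min d p f s u \<delta> = d (f u) (f (u @ [\<delta>] @ \<eta>)) powr p / 2 powr (real s * p)"
proof -
  have "branch_min d p f s u \<delta>
      \<in> (\<lambda>\<eta>. d (f u) (f (u @ [\<delta>] @ \<eta>)) powr p / 2 powr (real s * p)) ` signs (2 ^ s - 1)"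
    unfolding branch_min_def by (rule Min_in) auto
  then show ?thesis using that by blast
qed

lemma branch_min_nonneg: "0 \<le> branch_min d p f s u \<delta>"
  unfolding branch_min_def by (subst Min_ge_iff) auto

lemma branch_min_0: "branch_min d p f 0 u \<delta> = d (f u) (f (u @ [\<delta>])) powr p"
  by (simp add: branch_min_def)

text \<open>
  The four-point inequality is applied to the origin \<open>f u\<close>, to the closest descendant of scale
  \<open>2 ^ s\<close> in the branch \<open>\<delta>\<close> as the midpoint, and to the closest descendants of that midpoint in
  its two branches. The function \<open>\<Phi>\<close> is the arithmetic mean in part (1) and the maximum in part (2).
\<close>

lemma branch_min_Suc:
  assumes "Metric_space X d"
    and four_point: "\<And>w x y z. w \<in> X \<Longrightarrow> x \<in> X \<Longrightarrow> y \<in> X \<Longrightarrow> z \<in> X \<Longrightarrow>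
      1 / 2 powr p * min (d w x powr p) (d w y powr p) + c * d x y powr p
      \<le> \<Phi> (d z w powr p) (max (d z x powr p) (d z y powr p))"
    and homogeneous: "\<And>r a b. r \<ge> 0 \<Longrightarrow> \<Phi> (r * a) (r * b) = r * \<Phi> a b"
    and "c \<ge> 0" and f: "f \<in> tree_verts h \<rightarrow> X"
    and u: "u \<in> signs a" and \<delta>: "\<delta> \<in> {-1, 1}" and le: "a + 2 ^ Suc s \<le> h"
  obtains z where "z \<in> signs (a + 2 ^ s)"
    "branch_min d p f (Suc s) u \<delta> + c * fork_min d p f s z
      \<le> \<Phi> (branch_min d p f s u \<delta>) (max (branch_min d p f s z (-1)) (branch_min d p f s z 1))"
proof -
  interpret Metric_space X d by fact
  define R where "R = 2 powr (real s * p)"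
  have R: "R > 0" by (simp add: R_def)
  \<comment> \<open>Doubling the scale multiplies the normalisation by \<open>2 powr p\<close>,
    which is exactly the factor in front of the minimum in the four-point inequality.\<close>
  have R2: "2 powr (real (Suc s) * p) = R * 2 powr p"
    by (simp add: R_def algebra_simps powr_add)
  have fX: "f v \<in> X" if "v \<in> signs b" "b \<le> h" for v b
    using f that signs_subset_tree_verts[of b h] by blast
  obtain \<eta> where \<eta>: "\<eta> \<in> signs (2 ^ s - 1)"
    and Bu: "branch_min d p f s u \<delta> = d (f u) (f (u @ [\<delta>] @ \<eta>)) powr p / R"
    unfolding R_def by (rule branch_min_attained)
  define z where "z = u @ [\<delta>] @ \<eta>"
  have z: "z \<in> signs (a + 2 ^ s)"
    unfolding z_def by (rule signs_append[OF u \<delta> \<eta>]) simp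
  \<comment> \<open>The chosen tip plays two roles: it is a minimiser at scale \<open>s\<close> seen
    from \<open>z\<close>, and at the same time a competitor at scale \<open>Suc s\<close> seen from
    \<open>u\<close>, because it lies \<open>2 ^ s\<close> levels below \<open>z\<close>.\<close>
  have tip: "\<exists>x. f x \<in> X \<and> branch_min d p f s z \<epsilon> = d (f z) (f x) powr p / R \<and>
      branch_min d p f (Suc s) u \<delta> \<le> d (f u) (f x) powr p / (R * 2 powr p) \<and>
      (\<exists>\<zeta>\<in>signs (2 ^ s - 1). x = z @ [\<epsilon>] @ \<zeta>)" if \<epsilon>: "\<epsilon> \<in> {-1, 1}" for \<epsilon>
  proof -
    obtain \<zeta> where \<zeta>: "\<zeta> \<in> signs (2 ^ s - 1)"
      and Bz: "branch_min d p f s z \<epsilon> = d (f z) (f (z @ [\<epsilon>] @ \<zeta>)) powr p / R"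
      unfolding R_def by (rule branch_min_attained)
    have "z @ [\<epsilon>] @ \<zeta> \<in> signs (a + 2 ^ Suc s)"
      by (rule signs_append[OF z \<epsilon> \<zeta>]) simp
    then have "f (z @ [\<epsilon>] @ \<zeta>) \<in> X" using fX le by blast
    moreover have "\<eta> @ [\<epsilon>] @ \<zeta> \<in> signs (2 ^ Suc s - 1)"
      by (rule signs_append[OF \<eta> \<epsilon> \<zeta>]) (use one_le_power[of "2::nat" s] in \<open>simp; linarith\<close>)
    from branch_min_le[OF this, of d p f u \<delta>]
    have "branch_min d p f (Suc s) u \<delta> \<le> d (f u) (f (z @ [\<epsilon>] @ \<zeta>)) powr p / (R * 2 powr p)"
      unfolding R2 by (simp add: z_def)
    ultimately show ?thesis using \<zeta> Bz by blast
  qed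
  obtain x \<xi> where x: "f x \<in> X" "branch_min d p f s z (-1) = d (f z) (f x) powr p / R"
      "branch_min d p f (Suc s) u \<delta> \<le> d (f u) (f x) powr p / (R * 2 powr p)"
      "\<xi> \<in> signs (2 ^ s - 1)" "x = z @ [-1] @ \<xi>"
    using tip[of "-1"] by auto
  obtain y \<upsilon> where y: "f y \<in> X" "branch_min d p f s z 1 = d (f z) (f y) powr p / R"
      "branch_min d p f (Suc s) u \<delta> \<le> d (f u) (f y) powr p / (R * 2 powr p)"
      "\<upsilon> \<in> signs (2 ^ s - 1)" "y = z @ [1] @ \<upsilon>"
    using tip[of 1] by auto
  have fu: "f u \<in> X" and fz: "f z \<in> X" using fX[OF u] fX[OF z] le by auto
  \<comment> \<open>Both tips are minimisers from \<open>z\<close>, one in each branch, so together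
    they form a fork at \<open>z\<close>.\<close>
  have "fork_min d p f s z \<le> d (f x) (f y) powr p / R"
    unfolding R_def x(5) y(5) by (rule fork_min_le[OF x(4) y(4)])
  then have "c * (R * fork_min d p f s z) \<le> c * d (f x) (f y) powr p"
    using R \<open>c \<ge> 0\<close> by (intro mult_left_mono) (simp_all add: field_simps)
  moreover have "R * branch_min d p f (Suc s) u \<delta>
      \<le> 1 / 2 powr p * min (d (f u) (f x) powr p) (d (f u) (f y) powr p)"
    using x(3) y(3) R by (simp add: field_simps min_def)
  ultimately have "R * (branch_min d p f (Suc s) u \<delta> + c * fork_min d p f s z)
      \<le> 1 / 2 powr p * min (d (f u) (f x) powr p) (d (f u) (f y) powr p) + c * d (f x) (f y) powr p"
    by (simp add: distrib_left mult.left_commute)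
  also have "\<dots> \<le> \<Phi> (d (f z) (f u) powr p) (max (d (f z) (f x) powr p) (d (f z) (f y) powr p))"
    by (rule four_point[OF fu x(1) y(1) fz])
  also have "\<dots> = \<Phi> (R * branch_min d p f s u \<delta>)
      (R * max (branch_min d p f s z (-1)) (branch_min d p f s z 1))"
    using R by (simp add: Bu[folded z_def] x(2) y(2) commute[of "f z" "f u"] max_mult_distrib_left)
  also have "\<dots> = R * \<Phi> (branch_min d p f s u \<delta>)
      (max (branch_min d p f s z (-1)) (branch_min d p f s z 1))"
    using R by (intro homogeneous) simp
  finally show ?thesis using that[OF z] R by simp
qed

section \<open>Summation over scales and maxima of branch minima\<close>

text \<open>Adding the steps for all \<open>s < k\<close> leaves \<open>A 0\<close> on the right,
  and \<open>A k\<close> is dropped by its sign. The recursion also yields the scale 0, which the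
  fork sums omit; nonnegativity of \<open>G 0\<close> allows it to be discarded.\<close>

lemma sum_le_of_telescope:
  fixes A G :: "nat \<Rightarrow> real"
  assumes step: "\<And>s. s < k \<Longrightarrow> A (Suc s) + c * G s \<le> A s"
    and "c \<ge> 0" "A k \<ge> 0" and G: "\<And>s. G s \<ge> 0"
  shows "c * (\<Sum>s = 1..k - 1. G s) \<le> A 0"
proof -
  have "A n + c * (\<Sum>s<n. G s) \<le> A 0" if "n \<le> k" for n
    using that
  proof (induction n)
    case (Suc n)
    then show ?case using step[of n] by (simp add: distrib_left)
  qed simp
  from this[of k] have "c * (\<Sum>s<k. G s) \<le> A 0" using \<open>A k \<ge> 0\<close> by simp
  moreover have "(\<Sum>s = 1..k - 1. G s) \<le> (\<Sum>s<k. G s)"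
    by (rule sum_mono2) (auto simp: G)
  ultimately show ?thesis using \<open>c \<ge> 0\<close> by (meson mult_left_mono order_trans)
qed

text \<open>The set \<open>U\<close> is left free to serve both parts: it is a single level in part
  (1), and the set of all vertices with at least \<open>2 ^ s\<close> levels below them in part
  (2).\<close>

definition branch_max ::
    "('a \<Rightarrow> 'a \<Rightarrow> real) \<Rightarrow> real \<Rightarrow> (int list \<Rightarrow> 'a) \<Rightarrow> nat \<Rightarrow> int list set \<Rightarrow> real" where
  "branch_max d p f s U = Max ((\<lambda>(u, \<delta>). branch_min d p f s u \<delta>) ` (U \<times> {-1, 1}))"

lemma branch_min_le_branch_max:
  assumes "finite U" "u \<in> U" "\<delta> \<in> {-1, 1}"
  shows "branch_min d p f s u \<delta> \<le> branch_max d p f s U"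
proof -
  have "(u, \<delta>) \<in> U \<times> {-1, 1}" using assms by blast
  from imageI[OF this, of "\<lambda>(u, \<delta>). branch_min d p f s u \<delta>"] show ?thesis
    unfolding branch_max_def using assms(1) by (intro Max_ge) simp_all
qed

lemma branch_max_attained:
  assumes "finite U" "U \<noteq> {}"
  obtains u \<delta> where "u \<in> U" "\<delta> \<in> {-1, 1}" "branch_max d p f s U = branch_min d p f s u \<delta>"
proof -
  have "branch_max d p f s U \<in> (\<lambda>(u, \<delta>). branch_min d p f s u \<delta>) ` (U \<times> {-1, 1})"
    unfolding branch_max_def by (rule Max_in) (use assms in auto)
  then show ?thesis by (elim imageE SigmaE) (use that in simp)
qed

lemma branch_max_nonneg:
  assumes "finite U" "U \<noteq> {}"
  shows "0 \<le> branch_max d p f s U"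
  by (rule branch_max_attained[OF assms, of d p f s]) (simp add: branch_min_nonneg)

lemma Min_fork_min_nonneg: "finite U \<Longrightarrow> U \<noteq> {} \<Longrightarrow> 0 \<le> (MIN \<epsilon>\<in>U. fork_min d p f s \<epsilon>)"
  by (subst Min_ge_iff) (auto simp: fork_min_nonneg)

text \<open>This pairs the two halves of each block of levels when the scale doubles.\<close>

lemma sum_lessThan_double:
  fixes g :: "nat \<Rightarrow> real"
  shows "(\<Sum>j<2 * n. g j) = (\<Sum>t<n. g (2 * t) + g (2 * t + 1))"
  by (induction n) auto

section \<open>Part (1): fork convexity by averaging over blocks of levels\<close>

lemma fork_convex_withI:
  assumes "Metric_space X d" "K > 0"
    and four_point: "\<And>w x y z. w \<in> X \<Longrightarrow> x \<in> X \<Longrightarrow> y \<in> X \<Longrightarrow> z \<in> X \<Longrightarrow>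
      1 / 2 powr p * min (d w x powr p) (d w y powr p) + d x y powr p / (4 powr p * K powr p)
      \<le> 1 / 2 * d z w powr p + 1 / 2 * max (d z x powr p) (d z y powr p)"
  shows "fork_convex_with X d p (4 * K)"
  unfolding fork_convex_with_def
proof (intro allI impI ballI)
  fix k :: nat and f assume f: "f \<in> tree_verts (2 ^ k) \<rightarrow> X"
  define c where "c = 1 / (4 * K) powr p"
  have c: "c > 0" using \<open>K > 0\<close> by (simp add: c_def)
  have four_point_c: "1 / 2 powr p * min (d w x powr p) (d w y powr p) + c * d x y powr p
      \<le> 1 / 2 * d z w powr p + 1 / 2 * max (d z x powr p) (d z y powr p)"
    if "w \<in> X" "x \<in> X" "y \<in> X" "z \<in> X" for w x y z
    using four_point[OF that] \<open>K > 0\<close> by (simp add: c_def powr_mult)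
  have homogeneous: "1 / 2 * (r * a) + 1 / 2 * (r * b) = r * (1 / 2 * a + 1 / 2 * b)" for r a b :: real
    by (simp add: distrib_left)
  have le_iff: "c * x \<le> y \<longleftrightarrow> x \<le> (4 * K) powr p * y" for x y
    using \<open>K > 0\<close> by (simp add: c_def pos_divide_le_eq mult.commute)
  define F where "F s t = (MIN \<epsilon> \<in> signs (t * 2 ^ (s + 1) - 2 ^ s). fork_min d p f s \<epsilon>)" for s t
  define G where "G s = 1 / 2 ^ (k - 1 - s) * (\<Sum>t = 1..2 ^ (k - 1 - s). F s t)" for s
  define \<beta> where "\<beta> s a = branch_max d p f s (signs a)" for s a
  \<comment> \<open>The levels below \<open>2 ^ k\<close> are cut into \<open>2 ^ (k - s)\<close>
    blocks of length \<open>2 ^ s\<close>, and the average runs over the first level of each block.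
    For \<open>s = k\<close> only the root remains; for \<open>s = 0\<close> every level from 0 to
    \<open>2 ^ k - 1\<close> occurs.\<close>
  define A where "A s = 1 / 2 ^ (k - s) * (\<Sum>t<2 ^ (k - s). \<beta> s (t * 2 ^ s))" for s
  have level: "\<beta> (Suc s) (t * 2 ^ Suc s) + c * F s (Suc t)
      \<le> 1 / 2 * (\<beta> s (2 * t * 2 ^ s) + \<beta> s ((2 * t + 1) * 2 ^ s))"
    if "s < k" "t < 2 ^ (k - 1 - s)" for s t
  proof -
    define a :: nat where "a = t * 2 ^ Suc s"
    \<comment> \<open>Block \<open>t\<close> of length \<open>2 ^ Suc s\<close> ends no later than
      level \<open>2 ^ k\<close>, so the descendants of \<open>u\<close> that are used stay inside
      the tree.\<close>
    have "Suc t * 2 ^ Suc s \<le> (2 ^ (k - 1 - s) * 2 ^ Suc s :: nat)"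
      using that by (intro mult_right_mono) auto
    also have "\<dots> = 2 ^ k" using that(1) by (subst power_add [symmetric]) simp
    finally have le: "a + 2 ^ Suc s \<le> 2 ^ k" by (simp add: a_def)
    \<comment> \<open>A maximiser is fixed for the larger scale only. The vertices \<open>u\<close>
      and \<open>z\<close> then lie on the first levels of the two halves of the block, where the
      maxima of scale \<open>s\<close> dominate their branch minima.\<close>
    obtain u \<delta> where u: "u \<in> signs a" "\<delta> \<in> {-1, 1}" "\<beta> (Suc s) a = branch_min d p f (Suc s) u \<delta>"
      unfolding \<beta>_def by (rule branch_max_attained[OF finite_signs signs_nonempty])
    obtain z where z: "z \<in> signs (a + 2 ^ s)" and
      *: "branch_min d p f (Suc s) u \<delta> + c * fork_min d p f s z
        \<le> 1 / 2 * branch_min d p f s u \<delta>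
          + 1 / 2 * max (branch_min d p f s z (-1)) (branch_min d p f s z 1)"
      by (rule branch_min_Suc[where \<Phi> = "\<lambda>a b. 1 / 2 * a + 1 / 2 * b",
          OF assms(1) four_point_c homogeneous less_imp_le[OF c] f u(1,2) le])
    \<comment> \<open>The forks of scale \<open>s\<close> in the definition branch at the middle
      level of a block, which is the level of \<open>z\<close>. The index is \<open>Suc t\<close>
      because the defining sum starts at 1 whereas blocks are numbered from 0.\<close>
    have fork_level: "Suc t * 2 ^ (s + 1) - 2 ^ s = a + 2 ^ s" by (simp add: a_def)
    have "F s (Suc t) \<le> fork_min d p f s z"
      unfolding F_def fork_level using z by (intro Min_le finite_imageI finite_signs imageI)
    then have "c * F s (Suc t) \<le> c * fork_min d p f s z" using c by simp
    moreover have "branch_min d p f s u \<delta> \<le> \<beta> s a"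
      "max (branch_min d p f s z (-1)) (branch_min d p f s z 1) \<le> \<beta> s (a + 2 ^ s)"
      unfolding \<beta>_def using u z by (auto intro!: branch_min_le_branch_max)
    ultimately have "\<beta> (Suc s) a + c * F s (Suc t) \<le> 1 / 2 * (\<beta> s a + \<beta> s (a + 2 ^ s))"
      using * u(3) by argo
    moreover have "2 * t * 2 ^ s = a" "(2 * t + 1) * 2 ^ s = a + 2 ^ s"
      by (simp_all add: a_def)
    ultimately show ?thesis by (simp only: a_def [symmetric])
  qed
  have step: "A (Suc s) + c * G s \<le> A s" if "s < k" for s
  proof -
    define n :: nat where "n = 2 ^ (k - 1 - s)"
    have ks: "k - s = Suc (k - 1 - s)" "k - Suc s = k - 1 - s" using that by simp_all
    \<comment> \<open>The number of blocks appears as a natural number in the summation range and as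
      a real number in the averaging factor.\<close>
    have n: "2 ^ (k - s) = 2 * n" and n': "2 ^ (k - s) = 2 * real n"
      unfolding ks(1) n_def by simp_all
    have "(\<Sum>t = 1..n. F s t) = (\<Sum>t<n. F s (Suc t))"
      by (rule sum.reindex_bij_witness[of _ Suc "\<lambda>t. t - 1"]) auto
    then have G_eq: "G s = 1 / n * (\<Sum>t<n. F s (Suc t))"
      unfolding G_def n_def by simp
    have A_eq: "A (Suc s) = 1 / n * (\<Sum>t<n. \<beta> (Suc s) (t * 2 ^ Suc s))"
      unfolding A_def ks(2) n_def by simp
    have "A (Suc s) + c * G s
        = 1 / n * (\<Sum>t<n. \<beta> (Suc s) (t * 2 ^ Suc s) + c * F s (Suc t))"
      unfolding A_eq G_eq sum.distrib sum_distrib_left[symmetric] distrib_left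
      by (simp only: mult.left_commute)
    also have "\<dots> \<le> 1 / n * (\<Sum>t<n. 1 / 2 * (\<beta> s (2 * t * 2 ^ s) + \<beta> s ((2 * t + 1) * 2 ^ s)))"
      using level[OF that] by (intro mult_left_mono sum_mono) (auto simp: n_def)
    also have "\<dots> = A s"
      unfolding A_def n n' sum_lessThan_double sum_distrib_left[symmetric] by simp
    finally show ?thesis .
  qed
  \<comment> \<open>At scale 0 the tail is empty, so a branch is a single edge from level
    \<open>l\<close> to level \<open>Suc l\<close>.\<close>
  have edge: "\<beta> 0 l \<le> (MAX \<epsilon> \<in> signs (Suc l). d (f (take l \<epsilon>)) (f \<epsilon>) powr p)" for l
  proof -
    obtain u \<delta> where u: "u \<in> signs l" "\<delta> \<in> {-1, 1}" "\<beta> 0 l = branch_min d p f 0 u \<delta>"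
      unfolding \<beta>_def by (rule branch_max_attained[OF finite_signs signs_nonempty])
    have "u @ [\<delta>] \<in> signs (Suc l)" "take l (u @ [\<delta>]) = u" using u by (auto simp: signs_def)
    then show ?thesis
      unfolding u(3) branch_min_0
      by (intro Max_ge) (auto intro!: image_eqI[of _ _ "u @ [\<delta>]"])
  qed
  \<comment> \<open>The definition indexes an edge by the level of its lower endpoint,
    \<open>\<beta> 0\<close> by that of its upper endpoint.\<close>
  have shift: "(\<Sum>l = 1..2 ^ k. MAX \<epsilon> \<in> signs l. d (f (take (l - 1) \<epsilon>)) (f \<epsilon>) powr p)
      = (\<Sum>l<2 ^ k. MAX \<epsilon> \<in> signs (Suc l). d (f (take l \<epsilon>)) (f \<epsilon>) powr p)"
    by (rule sum.reindex_bij_witness[of _ Suc "\<lambda>l. l - 1"]) auto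
  have "c * (\<Sum>s = 1..k - 1. G s) \<le> A 0"
  proof (rule sum_le_of_telescope[where A = A and k = k, OF step])
    show "0 \<le> A k" by (simp add: A_def \<beta>_def branch_max_nonneg)
    show "0 \<le> G s" for s
      unfolding G_def F_def by (intro mult_nonneg_nonneg sum_nonneg Min_fork_min_nonneg) auto
  qed (use c in auto)
  also have "A 0 \<le> 1 / 2 ^ k *
      (\<Sum>l = 1..2 ^ k. MAX \<epsilon> \<in> signs l. d (f (take (l - 1) \<epsilon>)) (f \<epsilon>) powr p)"
    unfolding A_def shift using edge by (simp add: sum_mono divide_right_mono)
  finally have "(\<Sum>s = 1..k - 1. G s) \<le> (4 * K) powr p * (1 / 2 ^ k *
      (\<Sum>l = 1..2 ^ k. MAX \<epsilon> \<in> signs l. d (f (take (l - 1) \<epsilon>)) (f \<epsilon>) powr p))"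
    by (rule le_iff[THEN iffD1])
  then show "(\<Sum>s = 1..k - 1. 1 / 2 ^ (k - 1 - s) *
         (\<Sum>t = 1..2 ^ (k - 1 - s). MIN \<epsilon> \<in> signs (t * 2 ^ (s + 1) - 2 ^ s). fork_min d p f s \<epsilon>))
      \<le> (4 * K) powr p * (1 / 2 ^ k) *
         (\<Sum>l = 1..2 ^ k. MAX \<epsilon> \<in> signs l. d (f (take (l - 1) \<epsilon>)) (f \<epsilon>) powr p)"
    unfolding G_def F_def mult.assoc .
qed

section \<open>The tree metric and the Lipschitz constant\<close>

lemma tree_edgesI:
  assumes "u \<in> signs l" "l < h" "\<delta> \<in> {-1, 1}"
  shows "(u, u @ [\<delta>]) \<in> tree_edges h" "(u @ [\<delta>], u) \<in> tree_edges h"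
  using assms unfolding tree_edges_def Let_def by blast+

text \<open>Removing the last sign is a step to the parent, so induction from the end of the
  sequence reaches the root. Both directions are recorded in order to join two vertices through the
  root.\<close>

lemma tree_connected:
  assumes "u \<in> tree_verts h"
  shows "([], u) \<in> (tree_edges h)\<^sup>*" "(u, []) \<in> (tree_edges h)\<^sup>*"
proof -
  have "([], u) \<in> (tree_edges h)\<^sup>* \<and> (u, []) \<in> (tree_edges h)\<^sup>*"
    if "u \<in> signs l" "l \<le> h" for u l
    using that
  proof (induction u arbitrary: l rule: rev_induct)
    case (snoc \<delta> u)
    then have "u \<in> signs (l - 1)" "l - 1 < h" "\<delta> \<in> {-1, 1}" by (auto simp: signs_def)
    then show ?case
      using snoc.IH[of "l - 1"] tree_edgesI[of u "l - 1" h \<delta>]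
      by (meson less_imp_le rtrancl.rtrancl_into_rtrancl converse_rtrancl_into_rtrancl)
  qed simp
  then show "([], u) \<in> (tree_edges h)\<^sup>*" "(u, []) \<in> (tree_edges h)\<^sup>*"
    using assms by (auto simp: tree_verts_def)
qed

text \<open>Connectedness makes the least walk length attained, and a walk of length 0 would
  identify its endpoints.\<close>

lemma tree_dist_pos:
  assumes "u \<in> tree_verts h" "v \<in> tree_verts h" "u \<noteq> v"
  shows "tree_dist h u v > 0"
proof -
  have "(u, v) \<in> (tree_edges h)\<^sup>*"
    using tree_connected assms by (meson rtrancl_trans)
  then obtain n where "(u, v) \<in> tree_edges h ^^ n" by (auto simp: rtrancl_power)
  then have "(u, v) \<in> tree_edges h ^^ tree_dist h u v"
    unfolding tree_dist_def by (rule LeastI)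
  then show ?thesis using assms(3) by (cases "tree_dist h u v") auto
qed

lemma tree_dist_edge: "(u, v) \<in> tree_edges h \<Longrightarrow> tree_dist h u v \<le> 1"
  unfolding tree_dist_def by (rule Least_le) simp

text \<open>Lower bounds on the infimum \<open>tree_Lip\<close> require a nonempty set. The sum of
  all image distances is a crude Lipschitz constant, since distinct vertices are at tree distance at
  least 1.\<close>

lemma tree_Lip_candidates_nonempty:
  assumes "Metric_space X d" and f: "f \<in> tree_verts h \<rightarrow> X"
  shows "{L. L \<ge> 0 \<and> (\<forall>u\<in>tree_verts h. \<forall>v\<in>tree_verts h.
    d (f u) (f v) \<le> L * real (tree_dist h u v))} \<noteq> {}"
proof -
  interpret Metric_space X d by fact
  define L where "L = (\<Sum>u\<in>tree_verts h. \<Sum>v\<in>tree_verts h. d (f u) (f v))"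
  have "L \<ge> 0" by (simp add: L_def sum_nonneg)
  moreover have "d (f u) (f v) \<le> L * real (tree_dist h u v)"
    if uv: "u \<in> tree_verts h" "v \<in> tree_verts h" for u v
  proof (cases "u = v")
    case True
    then show ?thesis using f uv \<open>L \<ge> 0\<close> by (auto simp: Pi_iff)
  next
    case False
    have "d (f u) (f v) \<le> (\<Sum>v\<in>tree_verts h. d (f u) (f v))"
      using uv by (intro member_le_sum) auto
    also have "\<dots> \<le> L"
      unfolding L_def using uv by (intro member_le_sum) (auto simp: sum_nonneg)
    also have "L * 1 \<le> L * real (tree_dist h u v)"
      using tree_dist_pos[OF uv False] \<open>L \<ge> 0\<close> by (intro mult_left_mono) auto
    finally show ?thesis by simp
  qed
  ultimately show ?thesis by blast
qed

text \<open>Adjacent vertices are at tree distance at most 1, so every candidate constant bounds the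
  image of an edge, and hence so does their infimum.\<close>

lemma tree_Lip_edge:
  assumes "Metric_space X d" "f \<in> tree_verts h \<rightarrow> X"
    and "u \<in> signs l" "l < h" "\<delta> \<in> {-1, 1}"
  shows "d (f u) (f (u @ [\<delta>])) \<le> tree_Lip d h f"
  unfolding tree_Lip_def
proof (rule cInf_greatest[OF tree_Lip_candidates_nonempty[OF assms(1,2)]], clarify)
  fix L :: real assume "L \<ge> 0"
    and L: "\<forall>u\<in>tree_verts h. \<forall>v\<in>tree_verts h. d (f u) (f v) \<le> L * real (tree_dist h u v)"
  have "u \<in> tree_verts h" "u @ [\<delta>] \<in> tree_verts h"
    using assms(3-5) signs_subset_tree_verts[of l h] signs_subset_tree_verts[of "Suc l" h]
    using signs_append[of u l \<delta> "[]" 0] by auto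
  then have "d (f u) (f (u @ [\<delta>])) \<le> L * real (tree_dist h u (u @ [\<delta>]))"
    using L by blast
  also have "\<dots> \<le> L * 1"
    using tree_dist_edge[OF tree_edgesI(1)[OF assms(3-5)]] \<open>L \<ge> 0\<close> by (intro mult_left_mono) auto
  finally show "d (f u) (f (u @ [\<delta>])) \<le> L" by simp
qed

section \<open>Part (2): infrasup-fork convexity by maxima over the tree\<close>

lemma isfork_convex_withI:
  assumes "Metric_space X d" "K > 0" "p > 0"
    and four_point: "\<And>w x y z. w \<in> X \<Longrightarrow> x \<in> X \<Longrightarrow> y \<in> X \<Longrightarrow> z \<in> X \<Longrightarrow>
      1 / 2 powr p * min (d w x powr p) (d w y powr p) + d x y powr p / (4 powr p * K powr p)
      \<le> max (d z w powr p) (max (d z x powr p) (d z y powr p))"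
  shows "isfork_convex_with X d p (4 * K)"
  unfolding isfork_convex_with_def
proof (intro allI impI ballI)
  fix k :: nat and f assume f: "f \<in> tree_verts (2 ^ k) \<rightarrow> X"
  interpret Metric_space X d by fact
  define c where "c = 1 / (4 * K) powr p"
  have c: "c > 0" using \<open>K > 0\<close> by (simp add: c_def)
  have four_point_c: "1 / 2 powr p * min (d w x powr p) (d w y powr p) + c * d x y powr p
      \<le> max (d z w powr p) (max (d z x powr p) (d z y powr p))"
    if "w \<in> X" "x \<in> X" "y \<in> X" "z \<in> X" for w x y z
    using four_point[OF that] \<open>K > 0\<close> by (simp add: c_def powr_mult)
  have homogeneous: "max (r * a) (r * b) = r * max a b" if "r \<ge> 0" for r a b :: real
    using that by (simp add: max_mult_distrib_left)
  define G where "G s = (MIN \<epsilon> \<in> tree_verts (2 ^ k - 2 ^ s). fork_min d p f s \<epsilon>)" for s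
  \<comment> \<open>The maximum on the right of the four-point inequality does not distinguish
    \<open>u\<close> from \<open>z\<close>, so no averaging over levels is needed: one maximum over
    all vertices with room for scale \<open>s\<close> decreases along \<open>s\<close>.\<close>
  define A where "A s = branch_max d p f s (tree_verts (2 ^ k - 2 ^ s))" for s
  have G: "0 \<le> G s" for s unfolding G_def by (rule Min_fork_min_nonneg) simp_all
  have step: "A (Suc s) + c * G s \<le> A s" if "s < k" for s
  proof -
    \<comment> \<open>This makes the truncated subtraction \<open>2 ^ k - 2 ^ Suc s\<close> a true
      difference.\<close>
    have pow: "(2::nat) ^ Suc s \<le> 2 ^ k" using that by (intro power_increasing) auto
    obtain u \<delta> where u: "u \<in> tree_verts (2 ^ k - 2 ^ Suc s)" "\<delta> \<in> {-1, 1}"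
        "A (Suc s) = branch_min d p f (Suc s) u \<delta>"
      unfolding A_def by (rule branch_max_attained[OF finite_tree_verts tree_verts_nonempty])
    from u(1) obtain a where a: "u \<in> signs a" "a \<le> 2 ^ k - 2 ^ Suc s"
      by (auto simp: tree_verts_def)
    then have le: "a + 2 ^ Suc s \<le> 2 ^ k" using pow by linarith
    obtain z where z: "z \<in> signs (a + 2 ^ s)" and
      *: "branch_min d p f (Suc s) u \<delta> + c * fork_min d p f s z
        \<le> max (branch_min d p f s u \<delta>) (max (branch_min d p f s z (-1)) (branch_min d p f s z 1))"
      by (rule branch_min_Suc[where \<Phi> = "max",
          OF assms(1) four_point_c homogeneous less_imp_le[OF c] f a(1) u(2) le])
    \<comment> \<open>Room for scale \<open>Suc s\<close> below \<open>u\<close> leaves room for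
      scale \<open>s\<close> below both \<open>u\<close> and \<open>z\<close>, as \<open>z\<close>
      lies \<open>2 ^ s\<close> levels deeper.\<close>
    have "a \<le> 2 ^ k - 2 ^ s" "a + 2 ^ s \<le> 2 ^ k - 2 ^ s"
      using le unfolding power_Suc by linarith+
    then have uv: "u \<in> tree_verts (2 ^ k - 2 ^ s)" "z \<in> tree_verts (2 ^ k - 2 ^ s)"
      using a(1) z signs_subset_tree_verts by blast+
    then have "G s \<le> fork_min d p f s z"
      unfolding G_def by (intro Min_le) auto
    then have "c * G s \<le> c * fork_min d p f s z" using c by simp
    moreover have "max (branch_min d p f s u \<delta>)
        (max (branch_min d p f s z (-1)) (branch_min d p f s z 1)) \<le> A s"
      unfolding A_def using u uv by (auto intro!: branch_min_le_branch_max)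
    ultimately show ?thesis using * u(3) by linarith
  qed
  \<comment> \<open>The edge from the root with sign 1 is always present, and its image has
    nonnegative length.\<close>
  have Lip: "0 \<le> tree_Lip d (2 ^ k) f"
    by (rule order_trans[OF nonneg tree_Lip_edge[OF assms(1) f, of "[]" 0 1]]) simp_all
  have "A 0 \<le> tree_Lip d (2 ^ k) f powr p"
  proof -
    obtain u \<delta> where u: "u \<in> tree_verts (2 ^ k - 2 ^ 0)" "\<delta> \<in> {-1, 1}"
        "A 0 = branch_min d p f 0 u \<delta>"
      unfolding A_def by (rule branch_max_attained[OF finite_tree_verts tree_verts_nonempty])
    from u(1) obtain a where a: "u \<in> signs a" "a \<le> 2 ^ k - 1"
      by (auto simp: tree_verts_def)
    \<comment> \<open>The strict bound on the level of \<open>u\<close> ensures that the edge below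
      \<open>u\<close> belongs to the tree.\<close>
    have "(0::nat) < 2 ^ k" by simp
    with a(2) have "a < 2 ^ k" by linarith
    from tree_Lip_edge[OF assms(1) f a(1) this u(2)] show ?thesis
      unfolding u(3) branch_min_0 using \<open>p > 0\<close> by (intro powr_mono2) auto
  qed
  moreover have "c * (\<Sum>s = 1..k - 1. G s) \<le> A 0"
    by (rule sum_le_of_telescope[where A = A and k = k, OF step]) (use c G in \<open>auto simp: A_def branch_max_nonneg\<close>)
  ultimately have "c * (\<Sum>s = 1..k - 1. G s) \<le> tree_Lip d (2 ^ k) f powr p" by linarith
  then have "(\<Sum>s = 1..k - 1. G s) \<le> (4 * K * tree_Lip d (2 ^ k) f) powr p"
    using \<open>K > 0\<close> Lip by (simp add: c_def powr_mult divide_simps mult_ac)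
  then have "(\<Sum>s = 1..k - 1. G s) powr (1 / p)
      \<le> ((4 * K * tree_Lip d (2 ^ k) f) powr p) powr (1 / p)"
    using \<open>p > 0\<close> G by (intro powr_mono2) (auto simp: sum_nonneg)
  also have "\<dots> = 4 * K * tree_Lip d (2 ^ k) f"
    using \<open>p > 0\<close> \<open>K > 0\<close> Lip by (simp add: powr_powr)
  finally show "(\<Sum>s = 1..k - 1. MIN \<epsilon> \<in> tree_verts (2 ^ k - 2 ^ s). fork_min d p f s \<epsilon>) powr (1 / p)
      \<le> 4 * K * tree_Lip d (2 ^ k) f"
    by (simp add: G_def)
qed

section \<open>From an admissible constant to the best constant\<close>

text \<open>The admissible constants are bounded below by 0, so their infimum is at most each of
  them.\<close>

lemma fork_convex_with_imp:
  assumes "fork_convex_with X d p C" "C > 0"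
  shows "fork_convex X d p" "fork_const X d p \<le> C"
  using assms unfolding fork_convex_def fork_const_def
  by (auto intro!: cInf_lower bdd_belowI[of _ 0])

lemma isfork_convex_with_imp:
  assumes "isfork_convex_with X d p C" "C > 0"
  shows "isfork_convex X d p" "isfork_const X d p \<le> C"
  using assms unfolding isfork_convex_def isfork_const_def
  by (auto intro!: cInf_lower bdd_belowI[of _ 0])

theorem theorem42:
  fixes p K :: real and X :: "'a set" and d :: "'a \<Rightarrow> 'a \<Rightarrow> real"
  assumes "p > 0" and "Metric_space X d" and "K > 0"
  shows
    "((\<forall>w\<in>X. \<forall>x\<in>X. \<forall>y\<in>X. \<forall>z\<in>X.
         1 / 2 powr p * min (d w x powr p) (d w y powr p) + d x y powr p / (4 powr p * K powr p)
         \<le> 1 / 2 * d z w powr p + 1 / 2 * max (d z x powr p) (d z y powr p))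
      \<longrightarrow> fork_convex X d p \<and> fork_const X d p \<le> 4 * K)
     \<and>
     ((\<forall>w\<in>X. \<forall>x\<in>X. \<forall>y\<in>X. \<forall>z\<in>X.
         1 / 2 powr p * min (d w x powr p) (d w y powr p) + d x y powr p / (4 powr p * K powr p)
         \<le> Max {d z w powr p, d z x powr p, d z y powr p})
      \<longrightarrow> isfork_convex X d p \<and> isfork_const X d p \<le> 4 * K)"
proof (intro conjI[where P = "_ \<longrightarrow> _"] impI)
  assume *: "\<forall>w\<in>X. \<forall>x\<in>X. \<forall>y\<in>X. \<forall>z\<in>X.
    1 / 2 powr p * min (d w x powr p) (d w y powr p) + d x y powr p / (4 powr p * K powr p)
    \<le> 1 / 2 * d z w powr p + 1 / 2 * max (d z x powr p) (d z y powr p)"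
  have "fork_convex_with X d p (4 * K)"
    by (rule fork_convex_withI[OF assms(2,3)]) (use * in blast)
  then show "fork_convex X d p \<and> fork_const X d p \<le> 4 * K"
    using fork_convex_with_imp[of X d p "4 * K"] \<open>K > 0\<close> by simp
next
  assume *: "\<forall>w\<in>X. \<forall>x\<in>X. \<forall>y\<in>X. \<forall>z\<in>X.
    1 / 2 powr p * min (d w x powr p) (d w y powr p) + d x y powr p / (4 powr p * K powr p)
    \<le> Max {d z w powr p, d z x powr p, d z y powr p}"
  \<comment> \<open>Simplification turns the \<open>Max\<close> of a three-element set into the
    nested binary \<open>max\<close>, the form in which the recursion takes \<Phi>.\<close>
  have "isfork_convex_with X d p (4 * K)"
    by (rule isfork_convex_withI[OF assms(2,3,1)]) (use * in simp)
  then show "isfork_convex X d p \<and> isfork_const X d p \<le> 4 * K"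
    using isfork_convex_with_imp[of X d p "4 * K"] \<open>K > 0\<close> by simp
qed

end
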